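(* Almost paracontact metric 3-dimensional Walker manifolds for which $\xi_3=0$ or $\xi_1=\xi_2=0$ (identically) are never paracontact metric.
   Context: An almost paracontact metric 3-dimensional Walker manifold $(M,\varphi,\xi,\eta,g)$ is a 3-manifold with coordinates $(x,y,z)$, $f\in C^\infty(M)$, and, with respect to $\{\partial_x,\partial_y,\partial_z\}$, $$g=\begin{pmatrix}0&0&1\\0&1&0\\1&0&f\end{pmatrix},\quad \varphi=\begin{pmatrix}-\xi_2&\xi_1+f\xi_3&-f\xi_2\\ \xi_3&0&-\xi_1\\0&-\xi_3&\xi_2\end{pmatrix},$$ $\xi=\xi_1\partial_x+\xi_2\partial_y+\xi_3\partial_z$, $\eta=\xi_3dx+\xi_2dy+(\xi_1+f\xi_3)dz$, where $\xi_1,\xi_2,\xi_3\in C^\infty(M)$ satisfy $\xi_2^2+f\xi_3^2+2\xi_1\xi_3=1$ (columns of $\varphi$ are the images of the basis vectors). Let $\phi(X,Y)=g(\varphi X,Y)$ and $d\eta(X,Y)=\frac12((\nabla_X\eta)Y-(\nabla_Y\eta)X)$, $\nabla$ the Levi-Civita connection. The manifold is paracontact metric if $\phi=d\eta$. *)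

theory Defs
  imports "HOL-Analysis.Analysis"
begin

section \<open>Smooth functions and vector fields on an open set\<close>

text \<open>The derivative at \<open>p\<close> in direction \<open>v\<close>. All definitions below are applied to an open
  set \<open>M\<close> and constrain the total functions involved only at the points of \<open>M\<close>.\<close>

definition dirderiv :: "('a::euclidean_space \<Rightarrow> 'b::real_normed_vector) \<Rightarrow> 'a \<Rightarrow> 'a \<Rightarrow> 'b" where
  "dirderiv h p v = frechet_derivative h (at p) v"

primrec Ck_on :: "nat \<Rightarrow> 'a::euclidean_space set \<Rightarrow> ('a \<Rightarrow> 'b::real_normed_vector) \<Rightarrow> bool" where
  "Ck_on 0 S h \<longleftrightarrow> continuous_on S h"
| "Ck_on (Suc k) S h \<longleftrightarrow>
     (\<forall>p\<in>S. h differentiable (at p)) \<and> (\<forall>v. Ck_on k S (\<lambda>p. dirderiv h p v))"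

definition smooth_on :: "'a::euclidean_space set \<Rightarrow> ('a \<Rightarrow> 'b::real_normed_vector) \<Rightarrow> bool" where
  "smooth_on S h \<longleftrightarrow> (\<forall>k. Ck_on k S h)"

text \<open>A manifold with global coordinates \<open>(x, y, z)\<close> is identified with its image
  \<open>M \<subseteq> \<real>\<^sup>3\<close>, and a vector field with its components with respect to the coordinate frame.\<close>

type_synonym vfield = "real^3 \<Rightarrow> real^3"

definition lie_bracket :: "vfield \<Rightarrow> vfield \<Rightarrow> vfield" where
  "lie_bracket X Y p = dirderiv Y p (X p) - dirderiv X p (Y p)"


section \<open>The Levi-Civita connection\<close>

text \<open>A metric is given by its matrix in the coordinate frame.\<close>

definition met :: "(real^3 \<Rightarrow> real^3^3) \<Rightarrow> real^3 \<Rightarrow> real^3 \<Rightarrow> real^3 \<Rightarrow> real" where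
  "met G p v w = v \<bullet> (G p *v w)"

definition affine_connection :: "(real^3) set \<Rightarrow> (vfield \<Rightarrow> vfield \<Rightarrow> vfield) \<Rightarrow> bool" where
  "affine_connection M nabla \<longleftrightarrow>
    (\<forall>X Y. smooth_on M X \<longrightarrow> smooth_on M Y \<longrightarrow> smooth_on M (nabla X Y)) \<and>
    (\<forall>X X' Y. smooth_on M X \<longrightarrow> smooth_on M X' \<longrightarrow> smooth_on M Y \<longrightarrow>
      (\<forall>p\<in>M. nabla (\<lambda>q. X q + X' q) Y p = nabla X Y p + nabla X' Y p)) \<and>
    (\<forall>h X Y. smooth_on M h \<longrightarrow> smooth_on M X \<longrightarrow> smooth_on M Y \<longrightarrow>
      (\<forall>p\<in>M. nabla (\<lambda>q. h q *\<^sub>R X q) Y p = h p *\<^sub>R nabla X Y p)) \<and>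
    (\<forall>X Y Y'. smooth_on M X \<longrightarrow> smooth_on M Y \<longrightarrow> smooth_on M Y' \<longrightarrow>
      (\<forall>p\<in>M. nabla X (\<lambda>q. Y q + Y' q) p = nabla X Y p + nabla X Y' p)) \<and>
    (\<forall>h X Y. smooth_on M h \<longrightarrow> smooth_on M X \<longrightarrow> smooth_on M Y \<longrightarrow>
      (\<forall>p\<in>M. nabla X (\<lambda>q. h q *\<^sub>R Y q) p = dirderiv h p (X p) *\<^sub>R Y p + h p *\<^sub>R nabla X Y p))"

definition torsion_free :: "(real^3) set \<Rightarrow> (vfield \<Rightarrow> vfield \<Rightarrow> vfield) \<Rightarrow> bool" where
  "torsion_free M nabla \<longleftrightarrow>
    (\<forall>X Y. smooth_on M X \<longrightarrow> smooth_on M Y \<longrightarrow>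
      (\<forall>p\<in>M. nabla X Y p - nabla Y X p = lie_bracket X Y p))"

definition metric_compatible ::
  "(real^3) set \<Rightarrow> (real^3 \<Rightarrow> real^3^3) \<Rightarrow> (vfield \<Rightarrow> vfield \<Rightarrow> vfield) \<Rightarrow> bool" where
  "metric_compatible M G nabla \<longleftrightarrow>
    (\<forall>X Y Z. smooth_on M X \<longrightarrow> smooth_on M Y \<longrightarrow> smooth_on M Z \<longrightarrow>
      (\<forall>p\<in>M. dirderiv (\<lambda>q. met G q (X q) (Y q)) p (Z p)
        = met G p (nabla Z X p) (Y p) + met G p (X p) (nabla Z Y p)))"

definition levi_civita ::
  "(real^3) set \<Rightarrow> (real^3 \<Rightarrow> real^3^3) \<Rightarrow> (vfield \<Rightarrow> vfield \<Rightarrow> vfield) \<Rightarrow> bool" where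
  "levi_civita M G nabla \<longleftrightarrow>
    affine_connection M nabla \<and> torsion_free M nabla \<and> metric_compatible M G nabla"


section \<open>Paracontact metric structures\<close>

text \<open>One-forms are functions \<open>\<eta> p v\<close> that are linear in \<open>v\<close>; endomorphism fields are given by
  matrices acting on column vectors.\<close>

definition cov_deriv_form ::
  "(vfield \<Rightarrow> vfield \<Rightarrow> vfield) \<Rightarrow> (real^3 \<Rightarrow> real^3 \<Rightarrow> real) \<Rightarrow> vfield \<Rightarrow> vfield \<Rightarrow> real^3 \<Rightarrow> real" where
  "cov_deriv_form nabla \<eta> X Y p = dirderiv (\<lambda>q. \<eta> q (Y q)) p (X p) - \<eta> p (nabla X Y p)"

definition d_form ::
  "(vfield \<Rightarrow> vfield \<Rightarrow> vfield) \<Rightarrow> (real^3 \<Rightarrow> real^3 \<Rightarrow> real) \<Rightarrow> vfield \<Rightarrow> vfield \<Rightarrow> real^3 \<Rightarrow> real" where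
  "d_form nabla \<eta> X Y p = (cov_deriv_form nabla \<eta> X Y p - cov_deriv_form nabla \<eta> Y X p) / 2"

definition fundamental_form ::
  "(real^3 \<Rightarrow> real^3^3) \<Rightarrow> (real^3 \<Rightarrow> real^3^3) \<Rightarrow> vfield \<Rightarrow> vfield \<Rightarrow> real^3 \<Rightarrow> real" where
  "fundamental_form G \<phi> X Y p = met G p (\<phi> p *v X p) (Y p)"

definition paracontact_metric ::
  "(real^3) set \<Rightarrow> (real^3 \<Rightarrow> real^3^3) \<Rightarrow> (vfield \<Rightarrow> vfield \<Rightarrow> vfield) \<Rightarrow>
   (real^3 \<Rightarrow> real^3^3) \<Rightarrow> (real^3 \<Rightarrow> real^3 \<Rightarrow> real) \<Rightarrow> bool" where
  "paracontact_metric M G nabla \<phi> \<eta> \<longleftrightarrow>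
    (\<forall>X Y. smooth_on M X \<longrightarrow> smooth_on M Y \<longrightarrow>
      (\<forall>p\<in>M. fundamental_form G \<phi> X Y p = d_form nabla \<eta> X Y p))"


section \<open>Almost paracontact metric Walker 3-manifolds\<close>

definition walker_metric :: "(real^3 \<Rightarrow> real) \<Rightarrow> real^3 \<Rightarrow> real^3^3" where
  "walker_metric f p = vector
     [vector [0, 0, 1],
      vector [0, 1, 0],
      vector [1, 0, f p]]"

definition walker_phi ::
  "(real^3 \<Rightarrow> real) \<Rightarrow> (real^3 \<Rightarrow> real) \<Rightarrow> (real^3 \<Rightarrow> real) \<Rightarrow> (real^3 \<Rightarrow> real) \<Rightarrow> real^3 \<Rightarrow> real^3^3" where
  "walker_phi f \<xi>1 \<xi>2 \<xi>3 p = vector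
     [vector [- \<xi>2 p, \<xi>1 p + f p * \<xi>3 p, - f p * \<xi>2 p],
      vector [\<xi>3 p, 0, - \<xi>1 p],
      vector [0, - \<xi>3 p, \<xi>2 p]]"

definition walker_xi ::
  "(real^3 \<Rightarrow> real) \<Rightarrow> (real^3 \<Rightarrow> real) \<Rightarrow> (real^3 \<Rightarrow> real) \<Rightarrow> vfield" where
  "walker_xi \<xi>1 \<xi>2 \<xi>3 p = vector [\<xi>1 p, \<xi>2 p, \<xi>3 p]"

definition walker_eta ::
  "(real^3 \<Rightarrow> real) \<Rightarrow> (real^3 \<Rightarrow> real) \<Rightarrow> (real^3 \<Rightarrow> real) \<Rightarrow> (real^3 \<Rightarrow> real) \<Rightarrow>
   real^3 \<Rightarrow> real^3 \<Rightarrow> real" where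
  "walker_eta f \<xi>1 \<xi>2 \<xi>3 p v = \<xi>3 p * v$1 + \<xi>2 p * v$2 + (\<xi>1 p + f p * \<xi>3 p) * v$3"

definition almost_paracontact_walker ::
  "(real^3) set \<Rightarrow> (real^3 \<Rightarrow> real) \<Rightarrow> (real^3 \<Rightarrow> real) \<Rightarrow> (real^3 \<Rightarrow> real) \<Rightarrow> (real^3 \<Rightarrow> real) \<Rightarrow> bool" where
  "almost_paracontact_walker M f \<xi>1 \<xi>2 \<xi>3 \<longleftrightarrow>
    open M \<and> M \<noteq> {} \<and>
    smooth_on M f \<and> smooth_on M \<xi>1 \<and> smooth_on M \<xi>2 \<and> smooth_on M \<xi>3 \<and>
    (\<forall>p\<in>M. (\<xi>2 p)\<^sup>2 + f p * (\<xi>3 p)\<^sup>2 + 2 * \<xi>1 p * \<xi>3 p = 1)"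

lemma walker_structure:
  assumes "almost_paracontact_walker M f \<xi>1 \<xi>2 \<xi>3" and "p \<in> M"
  defines "\<phi> \<equiv> walker_phi f \<xi>1 \<xi>2 \<xi>3 p" and "\<xi> \<equiv> walker_xi \<xi>1 \<xi>2 \<xi>3 p"
    and "\<eta> \<equiv> walker_eta f \<xi>1 \<xi>2 \<xi>3 p" and "g \<equiv> met (walker_metric f) p"
  shows "\<eta> \<xi> = 1" and "\<phi> *v (\<phi> *v v) = v - \<eta> v *\<^sub>R \<xi>" and "\<eta> v = g v \<xi>"
    and "g (\<phi> *v v) (\<phi> *v w) = - g v w + \<eta> v * \<eta> w"
proof -
  have c: "(\<xi>2 p)\<^sup>2 + f p * (\<xi>3 p)\<^sup>2 + 2 * \<xi>1 p * \<xi>3 p = 1"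
    using assms(1,2) by (simp add: almost_paracontact_walker_def)
  note d = \<phi>_def \<xi>_def \<eta>_def g_def walker_phi_def walker_xi_def walker_eta_def walker_metric_def
    met_def inner_vec_def matrix_vector_mult_def sum_3 vec_eq_iff forall_3
  show "\<eta> \<xi> = 1" using c by (simp add: d power2_eq_square algebra_simps)
  show "\<phi> *v (\<phi> *v v) = v - \<eta> v *\<^sub>R \<xi>"
    using c by (simp add: d) (intro conjI; algebra)
  show "\<eta> v = g v \<xi>" by (simp add: d algebra_simps)
  show "g (\<phi> *v v) (\<phi> *v w) = - g v w + \<eta> v * \<eta> w"
    using c by (simp add: d) algebra
qed


section \<open>Existence and uniqueness of the Levi-Civita connection\<close>

lemma Ck_on_cong:
  assumes "open S" "\<And>p. p \<in> S \<Longrightarrow> f p = g p" "Ck_on k S f"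
  shows "Ck_on k S g"
  using assms(2,3)
proof (induction k arbitrary: f g)
  case 0
  then show ?case by (simp cong: continuous_on_cong)
next
  case (Suc k)
  have hd: "(g has_derivative D) (at p)" if "p \<in> S" "(f has_derivative D) (at p)" for p D
    using has_derivative_transform_within_open[OF that(2) assms(1) that(1)] Suc.prems by auto
  have df: "(f has_derivative dirderiv f p) (at p)" if "p \<in> S" for p
    using Suc.prems(2) that unfolding dirderiv_def[abs_def] by (simp add: frechet_derivative_works[symmetric])
  have eq: "dirderiv f p v = dirderiv g p v" if "p \<in> S" for p v
    using frechet_derivative_at[OF hd[OF that df[OF that]]] by (simp add: dirderiv_def)
  have "Ck_on k S (\<lambda>p. dirderiv g p v)" for v
    by (rule Suc.IH[OF eq]) (use Suc.prems(2) in simp_all)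
  moreover have "g differentiable (at p)" if "p \<in> S" for p
    using hd[OF that df[OF that]] by (rule differentiableI)
  ultimately show ?case by simp
qed

lemma Ck_on_Suc_imp: "Ck_on (Suc k) S f \<Longrightarrow> Ck_on k S f"
proof (induction k arbitrary: f)
  case 0
  then have "continuous (at p) f" if "p \<in> S" for p
    using that by (simp add: differentiable_imp_continuous_within)
  then show ?case by (simp add: continuous_at_imp_continuous_on)
next
  case (Suc k)
  from Suc.prems have d: "\<forall>p\<in>S. f differentiable (at p)"
    and c: "\<And>v. Ck_on (Suc k) S (\<lambda>p. dirderiv f p v)"
    by (subst (asm) Ck_on.simps(2), blast)+
  show ?case using d Suc.IH[OF c] by (subst Ck_on.simps(2)) blast
qed

lemma Ck_on_const: "Ck_on k S (\<lambda>_. c)"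
  by (induction k arbitrary: c) (simp_all add: dirderiv_def)

lemma dirderiv_add:
  assumes "f differentiable (at p)" "g differentiable (at p)"
  shows "dirderiv (\<lambda>q. f q + g q) p v = dirderiv f p v + dirderiv g p v"
proof -
  have "((\<lambda>q. f q + g q) has_derivative (\<lambda>v. dirderiv f p v + dirderiv g p v)) (at p)"
    using assms unfolding frechet_derivative_works dirderiv_def
    by (rule has_derivative_add)
  from fun_cong[OF frechet_derivative_at[OF this], of v] show ?thesis by (simp only: dirderiv_def)
qed

lemma Ck_on_add:
  assumes "open S" "Ck_on k S f" "Ck_on k S g"
  shows "Ck_on k S (\<lambda>p. f p + g p)"
  using assms(2,3)
proof (induction k arbitrary: f g)
  case 0
  then show ?case by (simp add: continuous_on_add)
next
  case (Suc k)
  have "Ck_on k S (\<lambda>p. dirderiv (\<lambda>p. f p + g p) p v)" for v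
    by (rule Ck_on_cong[OF assms(1) _ Suc.IH[of "\<lambda>p. dirderiv f p v" "\<lambda>p. dirderiv g p v"]])
      (use Suc.prems in \<open>auto simp: dirderiv_add\<close>)
  then show ?case using Suc.prems by auto
qed

lemma dirderiv_scaleR:
  assumes "f differentiable (at p)" "g differentiable (at p)"
  shows "dirderiv (\<lambda>p. f p *\<^sub>R g p) p v = f p *\<^sub>R dirderiv g p v + dirderiv f p v *\<^sub>R g p"
proof -
  have "((\<lambda>p. f p *\<^sub>R g p) has_derivative
     (\<lambda>v. f p *\<^sub>R dirderiv g p v + dirderiv f p v *\<^sub>R g p)) (at p)"
    using assms unfolding frechet_derivative_works dirderiv_def
    by (rule has_derivative_scaleR)
  from fun_cong[OF frechet_derivative_at[OF this], of v] show ?thesis by (simp only: dirderiv_def)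
qed

lemma Ck_on_scaleR:
  assumes "open S" "Ck_on k S f" "Ck_on k S g"
  shows "Ck_on k S (\<lambda>p. f p *\<^sub>R g p)"
  using assms(2,3)
proof (induction k arbitrary: f g)
  case 0
  then show ?case by (simp add: continuous_on_scaleR)
next
  case (Suc k)
  have "Ck_on k S (\<lambda>p. dirderiv (\<lambda>p. f p *\<^sub>R g p) p v)" for v
    by (rule Ck_on_cong[OF assms(1) _ Ck_on_add[OF assms(1)
          Suc.IH[of f "\<lambda>p. dirderiv g p v"] Suc.IH[of "\<lambda>p. dirderiv f p v" g]]])
      (use Suc.prems Suc.prems[THEN Ck_on_Suc_imp] in \<open>auto simp: dirderiv_scaleR\<close>)
  then show ?case using Suc.prems by auto
qed

lemma dirderiv_bounded_linear:
  assumes "bounded_linear L" "f differentiable (at p)"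
  shows "dirderiv (\<lambda>p. L (f p)) p v = L (dirderiv f p v)"
proof -
  have "((\<lambda>p. L (f p)) has_derivative (\<lambda>v. L (dirderiv f p v))) (at p)"
    using assms unfolding frechet_derivative_works dirderiv_def
    by (simp add: bounded_linear.has_derivative)
  from fun_cong[OF frechet_derivative_at[OF this], of v] show ?thesis by (simp only: dirderiv_def)
qed

lemma Ck_on_bounded_linear:
  assumes "open S" "bounded_linear L" "Ck_on k S f"
  shows "Ck_on k S (\<lambda>p. L (f p))"
  using assms(3)
proof (induction k arbitrary: f)
  case 0
  then show ?case using assms(2) by (simp add: bounded_linear.continuous_on)
next
  case (Suc k)
  have "Ck_on k S (\<lambda>p. dirderiv (\<lambda>p. L (f p)) p v)" for v
    by (rule Ck_on_cong[OF assms(1) _ Suc.IH[of "\<lambda>p. dirderiv f p v"]])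
      (use Suc.prems in \<open>auto simp: dirderiv_bounded_linear[OF assms(2)]\<close>)
  moreover have "(\<lambda>p. L (f p)) differentiable (at p)" if "p \<in> S" for p
  proof -
    have "f differentiable (at p)" using Suc.prems that by simp
    then obtain D where "(f has_derivative D) (at p)" unfolding differentiable_def ..
    then show ?thesis by (rule differentiableI[OF bounded_linear.has_derivative[OF assms(2)]])
  qed
  ultimately show ?case by simp
qed

lemma smooth_on_differentiable: "smooth_on S f \<Longrightarrow> p \<in> S \<Longrightarrow> f differentiable (at p)"
  unfolding smooth_on_def by (metis Ck_on.simps(2))

lemma smooth_on_dirderiv: "smooth_on S f \<Longrightarrow> smooth_on S (\<lambda>p. dirderiv f p v)"
  unfolding smooth_on_def by (metis Ck_on.simps(2))

lemma smooth_on_const: "smooth_on S (\<lambda>_. c)"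
  by (simp add: smooth_on_def Ck_on_const)

lemma smooth_on_add: "open S \<Longrightarrow> smooth_on S f \<Longrightarrow> smooth_on S g \<Longrightarrow> smooth_on S (\<lambda>p. f p + g p)"
  by (simp add: smooth_on_def Ck_on_add)

lemma smooth_on_scaleR:
  "open S \<Longrightarrow> smooth_on S f \<Longrightarrow> smooth_on S g \<Longrightarrow> smooth_on S (\<lambda>p. f p *\<^sub>R g p)"
  by (simp add: smooth_on_def Ck_on_scaleR)

lemma smooth_on_mult:
  fixes f g :: "'a::euclidean_space \<Rightarrow> real"
  shows "open S \<Longrightarrow> smooth_on S f \<Longrightarrow> smooth_on S g \<Longrightarrow> smooth_on S (\<lambda>p. f p * g p)"
  using smooth_on_scaleR[of S f g] by simp

lemma smooth_on_nth: "open S \<Longrightarrow> smooth_on S X \<Longrightarrow> smooth_on S (\<lambda>p. X p $ i)"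
  by (simp add: smooth_on_def Ck_on_bounded_linear[OF _ bounded_linear_vec_nth])

lemma smooth_on_cong:
  "open S \<Longrightarrow> smooth_on S f \<Longrightarrow> (\<And>p. p \<in> S \<Longrightarrow> f p = g p) \<Longrightarrow> smooth_on S g"
  unfolding smooth_on_def by (blast intro: Ck_on_cong)

lemma dirderiv_nth:
  "X differentiable (at p) \<Longrightarrow> dirderiv (\<lambda>q. X q $ i) p v = dirderiv X p v $ i"
  by (rule dirderiv_bounded_linear[OF bounded_linear_vec_nth])

lemma linear_dirderiv: "h differentiable (at p) \<Longrightarrow> linear (dirderiv h p)"
  unfolding dirderiv_def by (rule linear_frechet_derivative)

lemma dirderiv_mult:
  fixes f g :: "'a::euclidean_space \<Rightarrow> real"
  shows "f differentiable (at p) \<Longrightarrow> g differentiable (at p) \<Longrightarrow>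
   dirderiv (\<lambda>q. f q * g q) p v = f p * dirderiv g p v + dirderiv f p v * g p"
  using dirderiv_scaleR[of f p g v] by simp

lemma vec3_expand: "(v::real^3) = v$1 *\<^sub>R axis 1 1 + v$2 *\<^sub>R axis 2 1 + v$3 *\<^sub>R axis 3 1"
  by (simp add: vec_eq_iff forall_3 axis_def)

lemma dirderiv_expand:
  fixes v :: "real^3"
  assumes "h differentiable (at p)"
  shows "dirderiv h p v = v$1 *\<^sub>R dirderiv h p (axis 1 1) + v$2 *\<^sub>R dirderiv h p (axis 2 1)
           + v$3 *\<^sub>R dirderiv h p (axis 3 1)"
  using linear_dirderiv[OF assms] by (subst vec3_expand[of v]) (simp add: linear_add linear_scale)

text \<open>The covariant derivative given by the Christoffel symbols of the Walker metric.\<close>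

definition walker_connection :: "(real^3 \<Rightarrow> real) \<Rightarrow> vfield \<Rightarrow> vfield \<Rightarrow> vfield" where
  "walker_connection f X Y p =
    (let fx = dirderiv f p (axis 1 1); fy = dirderiv f p (axis 2 1); fz = dirderiv f p (axis 3 1)
     in dirderiv Y p (X p)
        + (fx / 2 * (X p $ 1 * Y p $ 3 + X p $ 3 * Y p $ 1)
          + fy / 2 * (X p $ 2 * Y p $ 3 + X p $ 3 * Y p $ 2)
          + (fz + f p * fx) / 2 * (X p $ 3 * Y p $ 3)) *\<^sub>R axis 1 1
        + (- fy / 2 * (X p $ 3 * Y p $ 3)) *\<^sub>R axis 2 1
        + (- fx / 2 * (X p $ 3 * Y p $ 3)) *\<^sub>R axis 3 1)"

lemma levi_civita_walker_connection:
  assumes M: "open M" and f: "smooth_on M f"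
  shows "levi_civita M (walker_metric f) (walker_connection f)"
proof -
  note sm = smooth_on_add[OF M] smooth_on_scaleR[OF M] smooth_on_mult[OF M] smooth_on_const
    smooth_on_nth[OF M] smooth_on_dirderiv
  have half: "smooth_on M (\<lambda>p. h p / 2)" "smooth_on M (\<lambda>p. - h p / 2)"
    if "smooth_on M h" for h :: "real^3 \<Rightarrow> real"
    using smooth_on_mult[OF M that smooth_on_const[of M "1/2"]]
      smooth_on_mult[OF M that smooth_on_const[of M "-1/2"]] by simp_all
  have 1: "smooth_on M (walker_connection f X Y)" if X: "smooth_on M X" and Y: "smooth_on M Y" for X Y
  proof -
    have "smooth_on M (\<lambda>p. X p $ 1 *\<^sub>R dirderiv Y p (axis 1 1) + X p $ 2 *\<^sub>R dirderiv Y p (axis 2 1)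
           + X p $ 3 *\<^sub>R dirderiv Y p (axis 3 1))"
      using X Y by (intro sm) auto
    then have "smooth_on M (\<lambda>p. dirderiv Y p (X p))"
      by (rule smooth_on_cong[OF M])
        (use smooth_on_differentiable[OF Y] in \<open>metis dirderiv_expand\<close>)
    then show ?thesis
      unfolding walker_connection_def[abs_def] Let_def using X Y f
      by (intro sm half) auto
  qed
  note D = smooth_on_differentiable
  have 2: "walker_connection f (\<lambda>q. X q + X' q) Y p
      = walker_connection f X Y p + walker_connection f X' Y p"
    if "p \<in> M" "smooth_on M Y" for X X' Y p
    using linear_dirderiv[OF D[OF that(2,1)]]
    by (simp add: walker_connection_def Let_def linear_add vec_eq_iff forall_3 axis_def algebra_simps)
  have 3: "walker_connection f (\<lambda>q. h q *\<^sub>R X q) Y p = h p *\<^sub>R walker_connection f X Y p"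
    if "p \<in> M" "smooth_on M Y" for h X Y p
    using linear_dirderiv[OF D[OF that(2,1)]]
    by (simp add: walker_connection_def Let_def linear_scale vec_eq_iff forall_3 axis_def algebra_simps)
  have 4: "walker_connection f X (\<lambda>q. Y q + Y' q) p
      = walker_connection f X Y p + walker_connection f X Y' p"
    if "p \<in> M" "smooth_on M Y" "smooth_on M Y'" for X Y Y' p
    using D[OF that(2,1)] D[OF that(3,1)]
    by (simp add: walker_connection_def Let_def dirderiv_add vec_eq_iff forall_3 axis_def algebra_simps)
  have 5: "walker_connection f X (\<lambda>q. h q *\<^sub>R Y q) p
      = dirderiv h p (X p) *\<^sub>R Y p + h p *\<^sub>R walker_connection f X Y p"
    if "p \<in> M" "smooth_on M Y" "smooth_on M h" for h X Y p
    using D[OF that(2,1)] D[OF that(3,1)]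
    by (simp add: walker_connection_def Let_def dirderiv_scaleR vec_eq_iff forall_3 axis_def algebra_simps)
  have 6: "walker_connection f X Y p - walker_connection f Y X p = lie_bracket X Y p" for X Y p
    by (simp add: walker_connection_def Let_def lie_bracket_def vec_eq_iff forall_3 axis_def algebra_simps)
  have 7: "dirderiv (\<lambda>q. met (walker_metric f) q (X q) (Y q)) p (Z p)
        = met (walker_metric f) p (walker_connection f Z X p) (Y p)
          + met (walker_metric f) p (X p) (walker_connection f Z Y p)"
    if p: "p \<in> M" and X: "smooth_on M X" and Y: "smooth_on M Y" for X Y Z p
  proof -
    have met: "met (walker_metric f) q v w = v$1 * w$3 + v$2 * w$2 + v$3 * w$1 + f q * (v$3 * w$3)"
      for q v w
      by (simp add: met_def walker_metric_def inner_vec_def matrix_vector_mult_def sum_3 algebra_simps)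
    note dX = D[OF X p] and dY = D[OF Y p] and df = D[OF f p]
    have nX: "(\<lambda>q. X q $ i) differentiable (at p)" and nY: "(\<lambda>q. Y q $ i) differentiable (at p)" for i
      using D[OF smooth_on_nth[OF M X] p] D[OF smooth_on_nth[OF M Y] p] by auto
    show ?thesis
      unfolding met
      by (simp add: dirderiv_add dirderiv_mult nX nY df dirderiv_nth dX dY dirderiv_expand[OF df, of "Z p"]
          walker_connection_def Let_def axis_def field_simps)
  qed
  show ?thesis
    unfolding levi_civita_def affine_connection_def torsion_free_def metric_compatible_def
    by (intro conjI allI impI ballI) (rule 1 2 3 4 5 6 7; assumption)+
qed

lemma levi_civita_torsion:
  assumes "levi_civita M G nabla" "smooth_on M X" "smooth_on M Y" "p \<in> M"
  shows "nabla X Y p - nabla Y X p = lie_bracket X Y p"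
proof -
  have "torsion_free M nabla" using assms(1) by (simp only: levi_civita_def)
  from this[unfolded torsion_free_def, rule_format, OF assms(2-4)] show ?thesis .
qed

lemma levi_civita_metric:
  assumes "levi_civita M G nabla" "smooth_on M X" "smooth_on M Y" "smooth_on M Z" "p \<in> M"
  shows "dirderiv (\<lambda>q. met G q (X q) (Y q)) p (Z p)
     = met G p (nabla Z X p) (Y p) + met G p (X p) (nabla Z Y p)"
proof -
  have "metric_compatible M G nabla" using assms(1) by (simp only: levi_civita_def)
  from this[unfolded metric_compatible_def, rule_format, OF assms(2-5)] show ?thesis .
qed

lemma levi_civita_unique:
  assumes "levi_civita M G nabla" "levi_civita M G nabla'"
    and sym: "transpose (G p) = G p" and inv: "invertible (G p)"
    and X: "smooth_on M X" and Y: "smooth_on M Y" and p: "p \<in> M"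
  shows "nabla X Y p = nabla' X Y p"
proof -
  define A where "A X Y = nabla X Y p - nabla' X Y p" for X Y
  have As: "A X Y = A Y X" if "smooth_on M X" "smooth_on M Y" for X Y
    using levi_civita_torsion[OF assms(1) that p] levi_civita_torsion[OF assms(2) that p]
    unfolding A_def by (simp add: algebra_simps)
  have gs: "met G p v w = met G p w v" for v w
  proof -
    have "v \<bullet> (G p *v w) = (v v* G p) \<bullet> w" by (simp add: dot_lmul_matrix)
    also have "v v* G p = G p *v v" by (subst sym[symmetric]) simp
    finally show ?thesis by (simp add: met_def inner_commute)
  qed
  have Am: "met G p (A Z X) (Y p) = - met G p (A Z Y) (X p)"
    if "smooth_on M X" "smooth_on M Y" "smooth_on M Z" for X Y Z
  proof -
    have "met G p (nabla Z X p) (Y p) + met G p (X p) (nabla Z Y p)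
       = met G p (nabla' Z X p) (Y p) + met G p (X p) (nabla' Z Y p)"
      using levi_civita_metric[OF assms(1) that p] levi_civita_metric[OF assms(2) that p]
      by (rule trans[OF HOL.sym])
    then show ?thesis
      unfolding A_def gs[of "X p"] by (simp add: met_def inner_diff_left)
  qed
  have "met G p (A X Y) w = 0" for w
  proof -
    note W = smooth_on_const[of M w]
    show ?thesis
      using Am[OF Y W X] Am[OF W X Y] Am[OF X Y W]
      unfolding As[OF Y X] As[OF W X] As[OF W Y] by linarith
  qed
  moreover obtain B where "G p ** B = mat 1"
    using inv unfolding invertible_def by blast
  ultimately have "A X Y \<bullet> A X Y = 0"
    unfolding met_def by (metis matrix_vector_mul_assoc matrix_vector_mul_lid)
  then show ?thesis by (simp add: A_def)
qed

end

theory Submission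
  imports Defs
begin

text \<open>Evaluating \<open>\<phi> = d\<eta>\<close> on the coordinate fields gives, with \<open>\<eta>\<^sub>3 = \<xi>\<^sub>1 + f \<xi>\<^sub>3\<close>,
  \<open>\<partial>\<^sub>x \<xi>\<^sub>2 - \<partial>\<^sub>y \<xi>\<^sub>3 = 2 \<xi>\<^sub>3\<close>, \<open>\<partial>\<^sub>x \<eta>\<^sub>3 - \<partial>\<^sub>z \<xi>\<^sub>3 = - 2 \<xi>\<^sub>2\<close> and \<open>\<partial>\<^sub>y \<eta>\<^sub>3 - \<partial>\<^sub>z \<xi>\<^sub>2 = 2 \<xi>\<^sub>1\<close>.
  If \<open>\<xi>\<^sub>1 = \<xi>\<^sub>2 = 0\<close>, then \<open>f \<xi>\<^sub>3\<^sup>2 = 1\<close>, so \<open>f \<xi>\<^sub>3 = 1 / \<xi>\<^sub>3\<close>, and the third equation forces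
  \<open>\<partial>\<^sub>y \<xi>\<^sub>3 = 0\<close>, whence \<open>\<xi>\<^sub>3 = 0\<close> by the first. If \<open>\<xi>\<^sub>3 = 0\<close>, then \<open>\<xi>\<^sub>2 = \<plusminus>1\<close> is locally constant,
  \<open>\<partial>\<^sub>x \<xi>\<^sub>1 = - 2 \<xi>\<^sub>2\<close> and \<open>\<partial>\<^sub>y \<xi>\<^sub>1 = 2 \<xi>\<^sub>1\<close>; these are incompatible, because the increment of
  \<open>\<xi>\<^sub>1\<close> over a fixed step in the \<open>x\<close>-direction is a nonzero constant \<open>W\<close> with \<open>\<partial>\<^sub>y W = 2 W\<close>.\<close>

lemma dirderiv_eqI: "(h has_derivative D) (at p) \<Longrightarrow> dirderiv h p v = D v"
  unfolding dirderiv_def by (simp flip: frechet_derivative_at)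

lemma has_derivative_dirderiv: "h differentiable (at p) \<Longrightarrow> (h has_derivative dirderiv h p) (at p)"
  unfolding dirderiv_def[abs_def] by (simp flip: frechet_derivative_works)

lemma dirderiv_const: "dirderiv (\<lambda>_. c) p v = 0"
  by (simp add: dirderiv_eqI[OF has_derivative_const])

lemma dirderiv_cong:
  assumes "open S" "p \<in> S" "\<And>q. q \<in> S \<Longrightarrow> h q = k q" "k differentiable (at p)"
  shows "dirderiv h p v = dirderiv k p v"
  by (rule dirderiv_eqI, rule has_derivative_transform_within_open[OF
        has_derivative_dirderiv[OF assms(4)] assms(1,2)]) (simp add: assms(3))

text \<open>Convexity keeps the segment from \<open>q\<close> to \<open>q + v\<close> inside
  \<open>S\<close>. Along it \<open>t \<mapsto> h (q + t v)\<close> has constant derivative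
  \<open>c\<close>, and the mean value theorem on the unit interval concludes.\<close>

lemma increment_eq_of_dirderiv_const:
  fixes h :: "'a::euclidean_space \<Rightarrow> real"
  assumes S: "convex S" and q: "q \<in> S" "q + v \<in> S"
    and d: "\<And>r. r \<in> S \<Longrightarrow> h differentiable (at r)"
    and c: "\<And>r. r \<in> S \<Longrightarrow> dirderiv h r v = c"
  shows "h (q + v) - h q = c"
proof -
  have mem: "q + t *\<^sub>R v \<in> S" if "t \<in> {0..1}" for t
    using convexD_alt[OF S q, of t] that by (simp add: algebra_simps)
  have "((\<lambda>t. h (q + t *\<^sub>R v)) has_derivative (\<lambda>t. t * c)) (at t within {0..1})"
    if "0 \<le> t" "t \<le> 1" for t
  proof -
    have D: "(h has_derivative dirderiv h (q + t *\<^sub>R v)) (at (q + t *\<^sub>R v))"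
      using that by (intro has_derivative_dirderiv d mem) auto
    have "((\<lambda>t. h (q + t *\<^sub>R v)) has_derivative (\<lambda>s. dirderiv h (q + t *\<^sub>R v) (s *\<^sub>R v)))
        (at t within {0..1})"
      by (rule has_derivative_compose[where f="\<lambda>t. q + t *\<^sub>R v", OF _ D]) (auto intro!: derivative_eq_intros)
    moreover have "dirderiv h (q + t *\<^sub>R v) (s *\<^sub>R v) = s * c" for s
      using has_derivative_linear[OF D] c[OF mem[of t]] that by (simp add: linear_scale)
    ultimately show ?thesis by simp
  qed
  from mvt_very_simple[OF zero_le_one this] show ?thesis by auto
qed

text \<open>Differentiating \<open>h * h = 1\<close> gives \<open>2 h dh = 0\<close>, and
  \<open>h\<close> has no zero on \<open>M\<close>.\<close>

lemma dirderiv_eq_0_of_square_eq_1: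
  fixes h :: "'a::euclidean_space \<Rightarrow> real"
  assumes "open M" "p \<in> M" "h differentiable (at p)" "\<And>q. q \<in> M \<Longrightarrow> (h q)\<^sup>2 = 1"
  shows "dirderiv h p v = 0"
proof -
  have "dirderiv (\<lambda>q. h q * h q) p v = dirderiv (\<lambda>_. 1) p v"
    by (rule dirderiv_cong[OF assms(1,2)]) (use assms(4) in \<open>auto simp: power2_eq_square\<close>)
  then have "2 * (h p * dirderiv h p v) = 0"
    by (simp add: dirderiv_mult assms(3) dirderiv_const)
  then show ?thesis using assms(4)[OF assms(2)] by auto
qed

text \<open>Comparing mixed second derivatives would ask for more than differentiability of
  \<open>h\<close>; a finite increment in direction \<open>v\<close> takes the place of the
  derivative along \<open>v\<close>.\<close>

lemma no_function_with_incompatible_partials: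
  fixes h k :: "'a::euclidean_space \<Rightarrow> real"
  assumes M: "open M" and p: "p \<in> M" and v: "v \<noteq> 0"
    and dh: "\<And>q. q \<in> M \<Longrightarrow> h differentiable (at q)"
    and dk: "\<And>q. q \<in> M \<Longrightarrow> k differentiable (at q)"
    and k: "\<And>q. q \<in> M \<Longrightarrow> (k q)\<^sup>2 = 1"
    and hv: "\<And>q. q \<in> M \<Longrightarrow> dirderiv h q v = a * k q"
    and hw: "\<And>q. q \<in> M \<Longrightarrow> dirderiv h q w = b * h q"
  shows "a * b = 0"
proof -
  obtain e where e: "e > 0" "ball p e \<subseteq> M" using M p openE by blast
  \<comment> \<open>The shift \<open>s v\<close> has length \<open>e / 2\<close>, so it carries
    \<open>ball p (e / 2)\<close> into \<open>ball p e\<close>, where \<open>k\<close> is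
    constant.\<close>
  define s where "s = e / (2 * norm v)"
  have s: "s > 0" "norm (s *\<^sub>R v) = e / 2" using e v by (auto simp: s_def)
  have kc: "k q = k p" if "q \<in> ball p e" for q
  proof -
    have "k (p + (q - p)) - k p = 0"
      by (rule increment_eq_of_dirderiv_const[of "ball p e"])
        (use e that dk k dirderiv_eq_0_of_square_eq_1[OF M _ dk k] in auto)
    then show ?thesis by simp
  qed
  define W where "W q = h (q + s *\<^sub>R v) - h q" for q
  have mem: "q \<in> ball p e" "q + s *\<^sub>R v \<in> ball p e" if "q \<in> ball p (e / 2)" for q
  proof -
    show "q \<in> ball p e" using that e by auto
    have "dist p (q + s *\<^sub>R v) \<le> dist p q + norm (s *\<^sub>R v)"
      by (metis dist_triangle dist_norm add_diff_cancel_left' dist_commute)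
    then show "q + s *\<^sub>R v \<in> ball p e" using that s(2) by simp
  qed
  have W: "W q = s * (a * k p)" if "q \<in> ball p (e / 2)" for q
    unfolding W_def
  proof (rule increment_eq_of_dirderiv_const[of "ball p e"])
    fix r assume r: "r \<in> ball p e"
    then show "h differentiable (at r)" using dh e by auto
    then show "dirderiv h r (s *\<^sub>R v) = s * (a * k p)"
      using linear_dirderiv[of h r] hv[of r] kc[OF r] r e by (simp add: linear_scale subset_iff)
  qed (use mem[OF that] in auto)
  have pe: "p \<in> ball p (e / 2)" using e by simp
  have M': "p \<in> M" "p + s *\<^sub>R v \<in> M" using mem[OF pe] e by auto
  have D: "(h has_derivative dirderiv h (p + s *\<^sub>R v)) (at (p + s *\<^sub>R v))"
    by (rule has_derivative_dirderiv[OF dh[OF M'(2)]])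
  have "(W has_derivative (\<lambda>u. dirderiv h (p + s *\<^sub>R v) u - dirderiv h p u)) (at p)"
    unfolding W_def[abs_def]
    by (rule has_derivative_diff[OF
          has_derivative_compose[where f="\<lambda>q. q + s *\<^sub>R v", OF _ D] has_derivative_dirderiv[OF dh[OF p]]]) (auto intro!: derivative_eq_intros)
  \<comment> \<open>The law \<open>hw\<close> is linear in \<open>h\<close>, so it passes to the
    difference of the values of \<open>h\<close> at \<open>p + s v\<close> and \<open>p\<close>. But
    \<open>W\<close> is constant near \<open>p\<close>, so \<open>b * W p\<close> vanishes.\<close>
  then have "dirderiv W p w = b * W p"
    by (simp add: dirderiv_eqI hw M' W_def algebra_simps)
  moreover have "dirderiv W p w = dirderiv (\<lambda>_. s * (a * k p)) p w"
    by (rule dirderiv_cong[OF open_ball pe W]) simp_all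
  ultimately have "b * (s * (a * k p)) = 0" by (simp add: dirderiv_const W[OF pe])
  then show ?thesis using s(1) k[OF p] by auto
qed

text \<open>Constant fields commute, so torsion-freeness makes the two connection terms
  cancel.\<close>

lemma d_form_const_fields:
  assumes "levi_civita M G nabla" "p \<in> M" "linear (\<eta> p)"
  shows "d_form nabla \<eta> (\<lambda>_. v) (\<lambda>_. w) p
    = (dirderiv (\<lambda>q. \<eta> q w) p v - dirderiv (\<lambda>q. \<eta> q v) p w) / 2"
proof -
  have "nabla (\<lambda>_. v) (\<lambda>_. w) p = nabla (\<lambda>_. w) (\<lambda>_. v) p"
    using levi_civita_torsion[OF assms(1) smooth_on_const smooth_on_const assms(2), of v w]
    by (simp add: lie_bracket_def dirderiv_const)
  then show ?thesis by (simp add: d_form_def cov_deriv_form_def)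
qed

lemma linear_walker_eta: "linear (walker_eta f \<xi>1 \<xi>2 \<xi>3 p)"
  by (rule linearI) (simp_all add: walker_eta_def algebra_simps)

lemma paracontact_walker_equations:
  assumes lc: "levi_civita M (walker_metric f) nabla"
    and pc: "paracontact_metric M (walker_metric f) nabla
      (walker_phi f \<xi>1 \<xi>2 \<xi>3) (walker_eta f \<xi>1 \<xi>2 \<xi>3)"
    and p: "p \<in> M"
  defines "\<eta>3 \<equiv> \<lambda>q. \<xi>1 q + f q * \<xi>3 q"
  shows "dirderiv \<xi>2 p (axis 1 1) - dirderiv \<xi>3 p (axis 2 1) = 2 * \<xi>3 p"
    and "dirderiv \<eta>3 p (axis 1 1) - dirderiv \<xi>3 p (axis 3 1) = - 2 * \<xi>2 p"
    and "dirderiv \<eta>3 p (axis 2 1) - dirderiv \<xi>2 p (axis 3 1) = 2 * \<xi>1 p"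
proof -
  let ?\<eta> = "walker_eta f \<xi>1 \<xi>2 \<xi>3"
  have eq: "met (walker_metric f) p (walker_phi f \<xi>1 \<xi>2 \<xi>3 p *v v) w
      = (dirderiv (\<lambda>q. ?\<eta> q w) p v - dirderiv (\<lambda>q. ?\<eta> q v) p w) / 2" for v w
    using pc[unfolded paracontact_metric_def, rule_format,
        OF smooth_on_const[of M v] smooth_on_const[of M w] p]
    by (simp add: fundamental_form_def d_form_const_fields[where \<eta>="?\<eta>", OF lc p linear_walker_eta])
  note d = walker_phi_def walker_eta_def walker_metric_def \<eta>3_def met_def inner_vec_def
    matrix_vector_mult_def sum_3 axis_def
  show "dirderiv \<xi>2 p (axis 1 1) - dirderiv \<xi>3 p (axis 2 1) = 2 * \<xi>3 p"
    using eq[of "axis 1 1" "axis 2 1"] by (simp add: d)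
  show "dirderiv \<eta>3 p (axis 1 1) - dirderiv \<xi>3 p (axis 3 1) = - 2 * \<xi>2 p"
    using eq[of "axis 1 1" "axis 3 1"] by (simp add: d)
  show "dirderiv \<eta>3 p (axis 2 1) - dirderiv \<xi>2 p (axis 3 1) = 2 * \<xi>1 p"
    using eq[of "axis 2 1" "axis 3 1"] by (simp add: d)
qed

theorem corollary4p1:
  fixes M :: "(real^3) set" and f \<xi>1 \<xi>2 \<xi>3 :: "real^3 \<Rightarrow> real"
    and nabla :: "vfield \<Rightarrow> vfield \<Rightarrow> vfield"
  assumes "almost_paracontact_walker M f \<xi>1 \<xi>2 \<xi>3"
    and "levi_civita M (walker_metric f) nabla"
    and "(\<forall>p\<in>M. \<xi>3 p = 0) \<or> (\<forall>p\<in>M. \<xi>1 p = 0 \<and> \<xi>2 p = 0)"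
  shows "\<not> paracontact_metric M (walker_metric f) nabla
            (walker_phi f \<xi>1 \<xi>2 \<xi>3) (walker_eta f \<xi>1 \<xi>2 \<xi>3)"
proof
  assume pc: "paracontact_metric M (walker_metric f) nabla
    (walker_phi f \<xi>1 \<xi>2 \<xi>3) (walker_eta f \<xi>1 \<xi>2 \<xi>3)"
  note E = paracontact_walker_equations[OF assms(2) pc]
  from assms(1) have M: "open M" "M \<noteq> {}"
    and sm: "smooth_on M f" "smooth_on M \<xi>1" "smooth_on M \<xi>2" "smooth_on M \<xi>3"
    and n: "\<And>p. p \<in> M \<Longrightarrow> (\<xi>2 p)\<^sup>2 + f p * (\<xi>3 p)\<^sup>2 + 2 * \<xi>1 p * \<xi>3 p = 1"
    by (auto simp: almost_paracontact_walker_def)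
  note D = sm[THEN smooth_on_differentiable]
  obtain p where p: "p \<in> M" using M(2) by blast
  from assms(3) show False
  proof
    assume 0: "\<forall>p\<in>M. \<xi>3 p = 0"
    have z3: "dirderiv \<xi>3 q v = 0" if "q \<in> M" for q v
      using dirderiv_cong[OF M(1) that, of \<xi>3 "\<lambda>_. 0" v] 0 by (simp add: dirderiv_const)
    have \<eta>3: "dirderiv (\<lambda>q. \<xi>1 q + f q * \<xi>3 q) q v = dirderiv \<xi>1 q v" if "q \<in> M" for q v
      by (rule dirderiv_cong[OF M(1) that]) (use 0 D(2)[OF that] in auto)
    have sq: "(\<xi>2 q)\<^sup>2 = 1" if "q \<in> M" for q
      using n[OF that] 0 that by simp
    have z2: "dirderiv \<xi>2 q v = 0" if "q \<in> M" for q v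
      by (rule dirderiv_eq_0_of_square_eq_1[OF M(1) that D(3)[OF that] sq])
    \<comment> \<open>The factor \<open>a = -2\<close> comes from the second equation and
      \<open>b = 2\<close> from the third.\<close>
    have "(-2) * 2 = (0::real)"
      by (rule no_function_with_incompatible_partials[where h=\<xi>1 and k=\<xi>2
            and v="axis 1 1" and w="axis 2 1", OF M(1) p])
        (use D sq E(2,3) z2 z3 \<eta>3 in \<open>simp_all add: axis_eq_0_iff\<close>)
    then show False by simp
  next
    assume 0: "\<forall>p\<in>M. \<xi>1 p = 0 \<and> \<xi>2 p = 0"
    let ?\<eta>3 = "\<lambda>q. \<xi>1 q + f q * \<xi>3 q" and ?e = "axis 2 1 :: real^3"
    have z2: "dirderiv \<xi>2 p v = 0" for v
      using dirderiv_cong[OF M(1) p, of \<xi>2 "\<lambda>_. 0" v] 0 by (simp add: dirderiv_const)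
    have d\<eta>3: "?\<eta>3 differentiable (at p)"
      using D[OF p] by simp
    \<comment> \<open>The normalization of the structure, written as a product so that the product
      rule applies without division.\<close>
    have one: "?\<eta>3 q * \<xi>3 q = 1" if "q \<in> M" for q
      using n[OF that] 0 that by (simp add: power2_eq_square algebra_simps)
    have "dirderiv (\<lambda>q. ?\<eta>3 q * \<xi>3 q) p ?e = dirderiv (\<lambda>_. 1) p ?e"
      by (rule dirderiv_cong[OF M(1) p one]) simp_all
    then have "?\<eta>3 p * dirderiv \<xi>3 p ?e + dirderiv ?\<eta>3 p ?e * \<xi>3 p = 0"
      by (subst (asm) dirderiv_mult[OF d\<eta>3 D(4)[OF p]]) (simp add: dirderiv_const)
    moreover have "dirderiv ?\<eta>3 p ?e = 0" "dirderiv \<xi>3 p ?e = - 2 * \<xi>3 p"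
      using E(1,3)[OF p] 0 p z2 by auto
    ultimately show False using one[OF p] by auto
  qed
qed

end
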